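(* Let $n\ge 1$ and $N=2^n$. Consider the following quantum circuit on $n$ qubits $Q_0,\dots,Q_{n-1}$, where the computational basis state $|j\rangle$, $j=\sum_{i=0}^{n-1} j_i2^i$, has bit $j_i$ on qubit $Q_i$: (i) apply a Hadamard gate to each qubit; (ii) for $k=0,1,\dots,n-2$, in this order, apply a CNOT gate with control $Q_k$ and target $Q_{k+1}$; (iii) apply SWAP gates reversing the qubit order (i.e. exchanging $Q_i$ and $Q_{n-1-i}$ for all $i$). Then the unitary implemented by this circuit is the sequency-ordered Walsh-Hadamard transform $H_S$, that is, for every $0\le j\le N-1$ it maps $$|j\rangle \mapsto \frac{1}{\sqrt N}\sum_{k=0}^{N-1}(-1)^{\sum_{r=0}^{n-1}k_{n-1-r}(j_r\oplus j_{r+1})}|k\rangle ,$$ where $j_n:=0$. Moreover, the circuit uses $O(n)$ Hadamard gates, $O(n)$ CNOT gates and $O(n)$ SWAP gates and has depth $O(n)=O(\log_2 N)$.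
   Context: For $0\le k\le N-1$ write $k=\sum_{i=0}^{n-1}k_i2^i$ with $k_i\in\{0,1\}$, and similarly for $j$; $\oplus$ is addition modulo $2$. The Hadamard gate is $H=\frac{1}{\sqrt2}\begin{pmatrix}1&1\\1&-1\end{pmatrix}$. A CNOT gate with control $Q_k$ and target $Q_l$ maps the basis bits $(b_k,b_l)$ to $(b_k,b_l\oplus b_k)$. The sequency-ordered Walsh-Hadamard transform $H_S$ is the linear map on the complex vector space spanned by $|0\rangle,\dots,|N-1\rangle$ defined by the displayed formula. Circuit depth is the number of layers of gates, the gates within one layer acting on disjoint qubits. *)

theory Defs
  imports
    Complex_Main
    "HOL-Library.Landau_Symbols"
    "Jordan_Normal_Form.Matrix"
    "Jordan_Normal_Form.Schur_Decomposition"
begin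

definition binary_digit :: "nat \<Rightarrow> nat \<Rightarrow> nat" where
  "binary_digit k i = of_bool (bit k i)"

abbreviation ket :: "nat \<Rightarrow> nat \<Rightarrow> complex vec" where
  "ket n j \<equiv> unit_vec (2 ^ n) j"

definition unitary_mat :: "nat \<Rightarrow> complex mat \<Rightarrow> bool" where
  "unitary_mat d U \<longleftrightarrow> U \<in> carrier_mat d d \<and>
     inverts_mat U (mat_adjoint U) \<and> inverts_mat (mat_adjoint U) U"

datatype gate =
    is_hadamard: Hadamard nat
  | is_cnot: CNOT nat nat
  | is_swap: SWAP nat nat

(* CNOT takes the control first, then the target. *)
fun gate_qubits :: "gate \<Rightarrow> nat set" where
  "gate_qubits (Hadamard q) = {q}"
| "gate_qubits (CNOT c t) = {c, t}"
| "gate_qubits (SWAP q r) = {q, r}"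

definition hadamard_mat :: "complex mat" where
  "hadamard_mat = complex_of_real (1 / sqrt 2) \<cdot>\<^sub>m mat_of_rows_list 2 [[1, 1], [1, -1]]"

(* The operator on n qubits that acts as the 2x2 matrix U on qubit q and as the identity
   on every other qubit. *)
definition single_qubit_mat :: "nat \<Rightarrow> nat \<Rightarrow> complex mat \<Rightarrow> complex mat" where
  "single_qubit_mat n q U = mat (2 ^ n) (2 ^ n) (\<lambda>(a, b).
     if \<forall>i<n. i \<noteq> q \<longrightarrow> bit a i = bit b i
     then U $$ (binary_digit a q, binary_digit b q) else 0)"

(* The operator sending each basis state with bits \<beta> to the basis state with bits f \<beta>. *)
definition bit_map_mat :: "nat \<Rightarrow> ((nat \<Rightarrow> bool) \<Rightarrow> nat \<Rightarrow> bool) \<Rightarrow> complex mat" where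
  "bit_map_mat n f = mat (2 ^ n) (2 ^ n) (\<lambda>(a, b).
     if \<forall>i<n. bit a i = f (bit b) i then 1 else 0)"

(* On truth values, addition modulo 2 is inequality. *)
fun gate_mat :: "nat \<Rightarrow> gate \<Rightarrow> complex mat" where
  "gate_mat n (Hadamard q) = single_qubit_mat n q hadamard_mat"
| "gate_mat n (CNOT c t) = bit_map_mat n (\<lambda>\<beta>. \<beta>(t := (\<beta> t \<noteq> \<beta> c)))"
| "gate_mat n (SWAP q r) = bit_map_mat n (\<lambda>\<beta>. \<beta>(q := \<beta> r, r := \<beta> q))"

(* The head of the list is the gate that is applied first. *)
fun circuit_mat :: "nat \<Rightarrow> gate list \<Rightarrow> complex mat" where
  "circuit_mat n [] = 1\<^sub>m (2 ^ n)"
| "circuit_mat n (g # gs) = circuit_mat n gs * gate_mat n g"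

(* An assignment of the gates to layers 0, ..., d - 1 in which gates sharing a qubit are
   in different layers and keep their order. *)
definition is_layering :: "gate list \<Rightarrow> nat \<Rightarrow> (nat \<Rightarrow> nat) \<Rightarrow> bool" where
  "is_layering gs d layer \<longleftrightarrow>
     (\<forall>i<length gs. layer i < d) \<and>
     (\<forall>i j. i < j \<and> j < length gs \<and> gate_qubits (gs ! i) \<inter> gate_qubits (gs ! j) \<noteq> {}
        \<longrightarrow> layer i < layer j)"

definition circuit_depth :: "gate list \<Rightarrow> nat" where
  "circuit_depth gs = (LEAST d. \<exists>layer. is_layering gs d layer)"

(* The exchanges of qubits i and n - 1 - i are listed once per unordered pair; for odd n
   the middle qubit stays in place. *)
definition sequency_circuit :: "nat \<Rightarrow> gate list" where
  "sequency_circuit n =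
     map Hadamard [0..<n] @
     map (\<lambda>k. CNOT k (k + 1)) [0..<n - 1] @
     map (\<lambda>i. SWAP i (n - 1 - i)) [0..<n div 2]"

(* The image of the basis state j. For j < 2 ^ n the digit of j at position n is 0, which
   is the convention needed for the summand r = n - 1. *)
definition sequency_walsh_image :: "nat \<Rightarrow> nat \<Rightarrow> complex vec" where
  "sequency_walsh_image n j =
     complex_of_real (1 / sqrt (2 ^ n)) \<cdot>\<^sub>v
       finsum_vec TYPE(complex) (2 ^ n)
         (\<lambda>k. (- 1) ^ (\<Sum>r<n. binary_digit k (n - 1 - r) *
                  ((binary_digit j r + binary_digit j (r + 1)) mod 2)) \<cdot>\<^sub>v ket n k)
         {0..<2 ^ n}"

definition sequency_walsh_mat :: "nat \<Rightarrow> complex mat" where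
  "sequency_walsh_mat n = mat_of_cols (2 ^ n) (map (sequency_walsh_image n) [0..<2 ^ n])"

end

theory Submission
  imports Defs
begin

text \<open>
  The CNOT cascade replaces the bits of a basis state by their prefix parities, and the SWAP gates
  reverse them. So entry \<open>(a, b)\<close> of the circuit is the entry \<open>(c, b)\<close> of the Hadamard layer, with
  \<open>c\<close> the unique index whose prefix parities are the bits of \<open>a\<close> in reverse order. That entry is,
  up to normalisation, the sign of the parity of \<open>\<Sum>i. c\<^sub>i b\<^sub>i\<close>, and summation by parts modulo 2 moves the
  differences from \<open>c\<close> to \<open>b\<close>. The depth is linear because it is at most the number of gates.
\<close>

section \<open>Indices built from bit functions, and sums over indices\<close>

definition basis_index :: "nat \<Rightarrow> (nat \<Rightarrow> bool) \<Rightarrow> nat" where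
  "basis_index n \<beta> = horner_sum of_bool 2 (map \<beta> [0..<n])"

lemma basis_index_less: "basis_index n \<beta> < 2 ^ n"
  using horner_sum_of_bool_2_less[of "map \<beta> [0..<n]", where 'a = nat]
  by (simp add: basis_index_def)

lemma bit_basis_index: "bit (basis_index n \<beta>) i \<longleftrightarrow> i < n \<and> \<beta> i"
  by (auto simp: basis_index_def bit_horner_sum_bit_iff)

lemma bit_nat_beyond:
  assumes "(a::nat) < 2 ^ n" "n \<le> i"
  shows "\<not> bit a i"
  using assms by (metis bit_take_bit_iff not_le take_bit_nat_eq_self)

lemma nat_eq_bitsI:
  assumes "(a::nat) < 2 ^ n" "b < 2 ^ n" "\<And>i. i < n \<Longrightarrow> bit a i = bit b i"
  shows "a = b"
  by (rule bit_eqI) (use assms bit_nat_beyond not_le in metis)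

text \<open>The bits below \<open>n\<close> determine an index below \<open>2 ^ n\<close>. This form
  turns the bitwise conditions in the gate matrices into equations with one explicit index, so that
  sums over intermediate indices collapse.\<close>

lemma bits_eq_iff_basis_index:
  assumes "c < 2 ^ n"
  shows "(\<forall>i<n. bit c i = \<beta> i) \<longleftrightarrow> c = basis_index n \<beta>"
  using assms basis_index_less[of n \<beta>]
  by (auto intro!: nat_eq_bitsI[of c n] simp: bit_basis_index)

lemma index_mult_square_mat:
  assumes "A \<in> carrier_mat d d" "B \<in> carrier_mat d d" "i < d" "j < d"
  shows "(A * B) $$ (i, j) = (\<Sum>k<d. A $$ (i, k) * B $$ (k, j))"
  using assms by (auto simp: scalar_prod_def lessThan_atLeast0 intro!: sum.cong)

lemma sum_single_index:
  fixes F :: "nat \<Rightarrow> 'a::comm_monoid_add"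
  assumes "c0 < d" "\<And>c. c < d \<Longrightarrow> P c \<longleftrightarrow> c = c0"
  shows "(\<Sum>c<d. if P c then F c else 0) = F c0"
proof -
  have "(\<Sum>c<d. if P c then F c else 0) = (\<Sum>c<d. if c = c0 then F c else 0)"
    using assms(2) by (intro sum.cong) auto
  then show ?thesis using assms(1) by simp
qed

text \<open>Once all bits other than bit \<open>q\<close> are prescribed, only that bit is free,
  which leaves two indices. A row of a single-qubit gate is supported on such a pair.\<close>

lemma sum_off_qubit:
  fixes F :: "nat \<Rightarrow> 'a::comm_monoid_add"
  assumes "q < n"
  shows "(\<Sum>c<2 ^ n. if \<forall>i<n. i \<noteq> q \<longrightarrow> bit a i = bit c i then F c else 0) =
           F (basis_index n ((bit a)(q := False))) + F (basis_index n ((bit a)(q := True)))"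
    (is "?L = F ?c0 + F ?c1")
proof -
  have ne: "?c0 \<noteq> ?c1"
    using assms by (metis bit_basis_index fun_upd_same)
  have eq: "(\<forall>i<n. i \<noteq> q \<longrightarrow> bit a i = bit c i) \<longleftrightarrow> c = ?c0 \<or> c = ?c1" if "c < 2 ^ n" for c
    unfolding bits_eq_iff_basis_index[OF that, symmetric] using assms
    by (cases "bit c q") auto
  have "?L = (\<Sum>c\<in>{..<2 ^ n} \<inter> {c. \<forall>i<n. i \<noteq> q \<longrightarrow> bit a i = bit c i}. F c)"
    by (simp add: sum.inter_restrict)
  also have "{..<2 ^ n} \<inter> {c. \<forall>i<n. i \<noteq> q \<longrightarrow> bit a i = bit c i} = {?c0, ?c1}"
    using eq basis_index_less by auto
  finally show ?thesis using ne by simp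
qed

subsection \<open>Unitary matrices\<close>

lemma dim_mat_adjoint [simp]:
  "dim_row (mat_adjoint A) = dim_col A" "dim_col (mat_adjoint A) = dim_row A"
  by (simp_all add: mat_adjoint_def)

lemma mat_adjoint_carrier [simp]: "A \<in> carrier_mat d d \<Longrightarrow> mat_adjoint A \<in> carrier_mat d d"
  by (auto intro: carrier_matI)

lemma index_mat_adjoint:
  assumes "A \<in> carrier_mat d d" "i < d" "j < d"
  shows "mat_adjoint A $$ (i, j) = cnj (A $$ (j, i))"
  using assms by (simp add: mat_adjoint_def mat_of_rows_index)

lemma mat_adjoint_mult:
  assumes A: "A \<in> carrier_mat d d" and B: "B \<in> carrier_mat d d"
  shows "mat_adjoint (A * B :: complex mat) = mat_adjoint B * mat_adjoint A"
proof (rule eq_matI)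
  have AB: "A * B \<in> carrier_mat d d" using A B by simp
  fix i j assume "i < dim_row (mat_adjoint B * mat_adjoint A)"
    "j < dim_col (mat_adjoint B * mat_adjoint A)"
  then have ij: "i < d" "j < d" using A B by auto
  show "mat_adjoint (A * B) $$ (i, j) = (mat_adjoint B * mat_adjoint A) $$ (i, j)"
    using ij A B AB
    by (simp add: index_mat_adjoint[of _ d] index_mult_square_mat[of _ d] mult.commute
        del: index_mult_mat)
qed simp_all

lemma unitary_mat_mult:
  assumes "unitary_mat d A" "unitary_mat d B"
  shows "unitary_mat d (A * B)"
proof -
  from assms have c: "A \<in> carrier_mat d d" "B \<in> carrier_mat d d"
    and A: "A * mat_adjoint A = 1\<^sub>m d" "mat_adjoint A * A = 1\<^sub>m d"
    and B: "B * mat_adjoint B = 1\<^sub>m d" "mat_adjoint B * B = 1\<^sub>m d"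
    by (auto simp: unitary_mat_def inverts_mat_def mat_adjoint_def)
  let ?A = "mat_adjoint A" and ?B = "mat_adjoint B"
  have c': "?A \<in> carrier_mat d d" "?B \<in> carrier_mat d d" using c by auto
  have "A * B * (?B * ?A) = A * (B * (?B * ?A))"
    by (rule assoc_mult_mat[OF c(1,2) mult_carrier_mat[OF c'(2,1)]])
  also have "B * (?B * ?A) = ?A"
    using left_mult_one_mat[OF c'(1)] B by (simp flip: assoc_mult_mat[OF c(2) c'(2,1)])
  finally have 1: "A * B * (?B * ?A) = 1\<^sub>m d" by (simp add: A)
  have "?B * ?A * (A * B) = ?B * (?A * (A * B))"
    by (rule assoc_mult_mat[OF c'(2,1) mult_carrier_mat[OF c]])
  also have "?A * (A * B) = B"
    using left_mult_one_mat[OF c(2)] A by (simp flip: assoc_mult_mat[OF c'(1) c])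
  finally have 2: "?B * ?A * (A * B) = 1\<^sub>m d" by (simp add: B)
  show ?thesis
    using 1 2 c c' by (auto simp: unitary_mat_def inverts_mat_def mat_adjoint_mult[OF c])
qed

text \<open>All gates of the circuit are Hermitian involutions, so their unitarity reduces to these
  two checks.\<close>

lemma unitary_matI_involution:
  assumes "A \<in> carrier_mat d d" "A * A = 1\<^sub>m d"
    and "\<And>i j. i < d \<Longrightarrow> j < d \<Longrightarrow> cnj (A $$ (j, i)) = A $$ (i, j)"
  shows "unitary_mat d A"
proof -
  have "mat_adjoint A = A"
    using assms by (intro eq_matI) (auto simp: index_mat_adjoint[OF assms(1)])
  then show ?thesis
    using assms by (auto simp: unitary_mat_def inverts_mat_def)
qed

subsection \<open>Gates acting on basis states by a map of bits\<close>

text \<open>An index records only the first \<open>n\<close> values of a bit function. Locality lets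
  a further map act on this truncation with the same result below \<open>n\<close>.\<close>

definition bit_local :: "nat \<Rightarrow> ((nat \<Rightarrow> bool) \<Rightarrow> nat \<Rightarrow> bool) \<Rightarrow> bool" where
  "bit_local n f \<longleftrightarrow> (\<forall>\<beta> \<gamma>. (\<forall>i<n. \<beta> i = \<gamma> i) \<longrightarrow> (\<forall>i<n. f \<beta> i = f \<gamma> i))"

lemma bit_map_mat_carrier [simp]: "bit_map_mat n f \<in> carrier_mat (2 ^ n) (2 ^ n)"
  by (simp add: bit_map_mat_def)

lemma index_bit_map_mat:
  "a < 2 ^ n \<Longrightarrow> b < 2 ^ n \<Longrightarrow>
     bit_map_mat n f $$ (a, b) = (if \<forall>i<n. bit a i = f (bit b) i then 1 else 0)"
  by (simp add: bit_map_mat_def)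

lemma bit_map_mat_cong:
  assumes "\<And>\<beta> i. i < n \<Longrightarrow> f \<beta> i = g \<beta> i"
  shows "bit_map_mat n f = bit_map_mat n g"
  using assms by (auto simp: bit_map_mat_def intro!: cong_mat)

lemma bit_map_mat_id: "bit_map_mat n (\<lambda>\<beta>. \<beta>) = 1\<^sub>m (2 ^ n)"
  by (rule eq_matI) (auto simp: bit_map_mat_def intro: nat_eq_bitsI)

text \<open>Column \<open>b\<close> of the right factor has a single 1, in row
  \<open>basis_index n (f (bit b))\<close>, so the sum over the intermediate index has one term. The
  map \<open>g\<close> then acts on a truncated bit function, which is where its locality
  enters.\<close>

lemma bit_map_mat_comp:
  assumes "bit_local n g"
  shows "bit_map_mat n g * bit_map_mat n f = bit_map_mat n (\<lambda>\<beta>. g (f \<beta>))"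
proof (rule eq_matI)
  fix a b
  assume "a < dim_row (bit_map_mat n (\<lambda>\<beta>. g (f \<beta>)))" "b < dim_col (bit_map_mat n (\<lambda>\<beta>. g (f \<beta>)))"
  then have ab: "a < 2 ^ n" "b < 2 ^ n" by (auto simp: bit_map_mat_def)
  let ?c = "basis_index n (f (bit b))"
  have "(bit_map_mat n g * bit_map_mat n f) $$ (a, b) =
      (\<Sum>c<2 ^ n. if \<forall>i<n. bit c i = f (bit b) i then bit_map_mat n g $$ (a, c) else 0)"
    using ab by (subst index_mult_square_mat[of _ "2 ^ n"])
      (auto simp: index_bit_map_mat intro!: sum.cong)
  also have "\<dots> = bit_map_mat n g $$ (a, ?c)"
    by (rule sum_single_index) (auto simp: bits_eq_iff_basis_index basis_index_less)
  also have "\<dots> = (if \<forall>i<n. bit a i = g (bit ?c) i then 1 else 0)"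
    using ab basis_index_less by (simp add: index_bit_map_mat)
  also have "\<forall>i<n. g (bit ?c) i = g (f (bit b)) i"
  proof -
    have "\<forall>i<n. bit ?c i = f (bit b) i" by (simp add: bit_basis_index)
    then show ?thesis using assms by (auto simp: bit_local_def)
  qed
  then have "(\<forall>i<n. bit a i = g (bit ?c) i) \<longleftrightarrow> (\<forall>i<n. bit a i = g (f (bit b)) i)" by auto
  finally show "(bit_map_mat n g * bit_map_mat n f) $$ (a, b) = bit_map_mat n (\<lambda>\<beta>. g (f \<beta>)) $$ (a, b)"
    using ab by (simp add: index_bit_map_mat)
qed (simp_all add: bit_map_mat_def)

text \<open>For an involution, \<open>a\<close> is the image of \<open>b\<close> exactly when
  \<open>b\<close> is the image of \<open>a\<close>, so the 0-1 matrix is symmetric; its square is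
  the matrix of the identity map.\<close>

lemma unitary_bit_map_mat:
  assumes loc: "bit_local n f" and inv: "\<And>\<beta>. f (f \<beta>) = \<beta>"
  shows "unitary_mat (2 ^ n) (bit_map_mat n f)"
proof (rule unitary_matI_involution)
  show "bit_map_mat n f * bit_map_mat n f = 1\<^sub>m (2 ^ n)"
    by (simp add: bit_map_mat_comp[OF loc] inv bit_map_mat_id)
  have *: "\<forall>i<n. \<gamma> i = f \<beta> i" if "\<forall>i<n. \<beta> i = f \<gamma> i" for \<beta> \<gamma>
  proof -
    have "\<forall>i<n. f \<beta> i = f (f \<gamma>) i" using loc that unfolding bit_local_def by blast
    then show ?thesis by (simp add: inv)
  qed
  show "cnj (bit_map_mat n f $$ (j, i)) = bit_map_mat n f $$ (i, j)" if "i < 2 ^ n" "j < 2 ^ n" for i j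
    using that *[of "bit i" "bit j"] *[of "bit j" "bit i"] by (auto simp: index_bit_map_mat)
qed simp

lemma bit_local_CNOT: "c < n \<Longrightarrow> bit_local n (\<lambda>\<beta>. \<beta>(t := (\<beta> t \<noteq> \<beta> c)))"
  by (auto simp: bit_local_def)

lemma bit_local_SWAP: "q < n \<Longrightarrow> r < n \<Longrightarrow> bit_local n (\<lambda>\<beta>. \<beta>(q := \<beta> r, r := \<beta> q))"
  by (auto simp: bit_local_def)

lemma single_qubit_mat_carrier [simp]: "single_qubit_mat n q U \<in> carrier_mat (2 ^ n) (2 ^ n)"
  by (simp add: single_qubit_mat_def)

lemma gate_mat_carrier [simp]: "gate_mat n g \<in> carrier_mat (2 ^ n) (2 ^ n)"
  by (cases g) auto

subsection \<open>Hadamard gates\<close>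

text \<open>Writing the four entries as one sign formula makes the exponents add up when Hadamard
  gates are multiplied.\<close>

lemma index_hadamard_mat:
  "hadamard_mat $$ (binary_digit a p, binary_digit b q) =
     complex_of_real (1 / sqrt 2) * (- 1) ^ (binary_digit a p * binary_digit b q)"
  by (auto simp: hadamard_mat_def binary_digit_def mat_of_rows_list_def)

lemma index_Hadamard:
  assumes "a < 2 ^ n" "b < 2 ^ n"
  shows "gate_mat n (Hadamard q) $$ (a, b) =
     (if \<forall>i<n. i \<noteq> q \<longrightarrow> bit a i = bit b i
      then complex_of_real (1 / sqrt 2) * (- 1) ^ (binary_digit a q * binary_digit b q) else 0)"
  using assms by (auto simp: single_qubit_mat_def index_hadamard_mat)

lemma index_Hadamard_mult:
  assumes "M \<in> carrier_mat (2 ^ n) (2 ^ n)" "a < 2 ^ n" "b < 2 ^ n" "q < n"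
  shows "(gate_mat n (Hadamard q) * M) $$ (a, b) =
    complex_of_real (1 / sqrt 2) * (M $$ (basis_index n ((bit a)(q := False)), b) +
      (- 1) ^ binary_digit a q * M $$ (basis_index n ((bit a)(q := True)), b))"
proof -
  have "(gate_mat n (Hadamard q) * M) $$ (a, b) =
    (\<Sum>c<2 ^ n. if \<forall>i<n. i \<noteq> q \<longrightarrow> bit a i = bit c i
      then complex_of_real (1 / sqrt 2) * (- 1) ^ (binary_digit a q * binary_digit c q) * M $$ (c, b) else 0)"
    using assms by (subst index_mult_square_mat[of _ "2 ^ n"])
      (auto simp: index_Hadamard simp del: gate_mat.simps intro!: sum.cong)
  then show ?thesis
    unfolding sum_off_qubit[OF \<open>q < n\<close>] using \<open>q < n\<close>
    by (simp add: binary_digit_def bit_basis_index algebra_simps)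
qed

lemma unitary_Hadamard:
  assumes q: "q < n"
  shows "unitary_mat (2 ^ n) (gate_mat n (Hadamard q))"
proof (rule unitary_matI_involution)
  let ?H = "gate_mat n (Hadamard q)"
  show "?H \<in> carrier_mat (2 ^ n) (2 ^ n)" by simp
  show "cnj (?H $$ (j, i)) = ?H $$ (i, j)" if "i < 2 ^ n" "j < 2 ^ n" for i j
    using that by (auto simp: index_Hadamard mult.commute simp del: gate_mat.simps)
  show "?H * ?H = 1\<^sub>m (2 ^ n)"
  proof (rule eq_matI)
    fix a b assume "a < dim_row (1\<^sub>m (2 ^ n) :: complex mat)" "b < dim_col (1\<^sub>m (2 ^ n) :: complex mat)"
    then have ab: "a < 2 ^ n" "b < 2 ^ n" by auto
    \<comment> \<open>This splits equality to match the entries of \<open>?H\<close>: if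
      \<open>a\<close> and \<open>b\<close> differ at most at \<open>q\<close>, the two products of
      entries are both 1/2 when the bits at \<open>q\<close> agree, and cancel when they
      differ.\<close>
    have eq: "a = b \<longleftrightarrow> (\<forall>i<n. i \<noteq> q \<longrightarrow> bit a i = bit b i) \<and> bit a q = bit b q"
      using ab by (auto intro!: nat_eq_bitsI[of a n b])
    have sqrt2: "complex_of_real (sqrt 2) * complex_of_real (sqrt 2) = 2"
      by (simp flip: of_real_mult)
    have "(?H * ?H) $$ (a, b) = (if a = b then 1 else 0)"
      unfolding eq using ab q
      by (subst index_Hadamard_mult)
        (auto simp: index_Hadamard basis_index_less bit_basis_index binary_digit_def sqrt2
          simp del: gate_mat.simps)
    then show "(?H * ?H) $$ (a, b) = 1\<^sub>m (2 ^ n) $$ (a, b)"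
      using ab by simp
  qed (simp_all add: single_qubit_mat_def)
qed

section \<open>Circuits as products of gate matrices, and the Hadamard layer\<close>

lemma circuit_mat_carrier [simp]: "circuit_mat n gs \<in> carrier_mat (2 ^ n) (2 ^ n)"
  by (induction gs) (auto intro: mult_carrier_mat[OF _ gate_mat_carrier])

lemma circuit_mat_append: "circuit_mat n (xs @ ys) = circuit_mat n ys * circuit_mat n xs"
proof (induction xs)
  case Nil
  then show ?case
    using right_mult_one_mat[OF circuit_mat_carrier] by simp
next
  case (Cons g xs)
  then show ?case
    by (simp add: assoc_mult_mat[of _ "2 ^ n" "2 ^ n" _ "2 ^ n" _ "2 ^ n"])
qed

lemma circuit_mat_singleton: "circuit_mat n [g] = gate_mat n g"
  using left_mult_one_mat[OF gate_mat_carrier] by (simp del: gate_mat.simps)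

lemma unitary_circuit_mat:
  assumes "\<And>g. g \<in> set gs \<Longrightarrow> unitary_mat (2 ^ n) (gate_mat n g)"
  shows "unitary_mat (2 ^ n) (circuit_mat n gs)"
  using assms
proof (induction gs)
  case Nil
  show ?case by (auto intro: unitary_matI_involution)
next
  case (Cons g gs)
  then show ?case by (auto intro!: unitary_mat_mult simp del: gate_mat.simps)
qed

text \<open>Induction over partial layers: bits from \<open>m\<close> on are still untouched and
  must agree. The next Hadamard combines two rows of the previous matrix, and only the row whose bit
  \<open>m\<close> equals that of \<open>b\<close> can contribute; it supplies the new summand of
  the exponent.\<close>

lemma index_Hadamard_layer:
  assumes "m \<le> n" "a < 2 ^ n" "b < 2 ^ n"
  shows "circuit_mat n (map Hadamard [0..<m]) $$ (a, b) =
    (if \<forall>i<n. m \<le> i \<longrightarrow> bit a i = bit b i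
     then complex_of_real (1 / sqrt 2) ^ m * (- 1) ^ (\<Sum>i<m. binary_digit a i * binary_digit b i) else 0)"
  using assms
proof (induction m arbitrary: a)
  case 0
  then show ?case by (auto intro: nat_eq_bitsI)
next
  case (Suc m)
  let ?M = "circuit_mat n (map Hadamard [0..<m])"
  let ?c = "\<lambda>v. basis_index n ((bit a)(m := v))"
  let ?s = "\<Sum>i<m. binary_digit a i * binary_digit b i"
  have m: "m < n" using Suc.prems by simp
  have le: "m \<le> i \<longleftrightarrow> i = m \<or> Suc m \<le> i" for i by auto
  have M: "?M $$ (?c v, b) =
      (if bit b m = v \<and> (\<forall>i<n. Suc m \<le> i \<longrightarrow> bit a i = bit b i)
       then complex_of_real (1 / sqrt 2) ^ m * (- 1) ^ ?s else 0)" for v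
  proof -
    have "(\<Sum>i<m. binary_digit (?c v) i * binary_digit b i) = ?s"
      using m by (intro sum.cong) (auto simp: binary_digit_def bit_basis_index)
    moreover have "(\<forall>i<n. m \<le> i \<longrightarrow> bit (?c v) i = bit b i) \<longleftrightarrow>
        bit b m = v \<and> (\<forall>i<n. Suc m \<le> i \<longrightarrow> bit a i = bit b i)"
      using m by (auto simp: bit_basis_index le)
    ultimately show ?thesis
      using Suc.IH[OF _ basis_index_less] Suc.prems by simp
  qed
  have "circuit_mat n (map Hadamard [0..<Suc m]) = gate_mat n (Hadamard m) * ?M"
    by (simp add: circuit_mat_append circuit_mat_singleton del: circuit_mat.simps gate_mat.simps)
  then have "circuit_mat n (map Hadamard [0..<Suc m]) $$ (a, b) =
      complex_of_real (1 / sqrt 2) * (?M $$ (?c False, b) + (- 1) ^ binary_digit a m * ?M $$ (?c True, b))"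
    using Suc.prems m by (simp add: index_Hadamard_mult del: gate_mat.simps)
  also have "\<dots> = (if \<forall>i<n. Suc m \<le> i \<longrightarrow> bit a i = bit b i
     then complex_of_real (1 / sqrt 2) ^ Suc m * (- 1) ^ (\<Sum>i<Suc m. binary_digit a i * binary_digit b i) else 0)"
    unfolding M by (auto simp: binary_digit_def)
  finally show ?case .
qed

subsection \<open>The CNOT and SWAP cascades\<close>

primrec prefix_parity :: "(nat \<Rightarrow> bool) \<Rightarrow> nat \<Rightarrow> bool" where
  "prefix_parity \<beta> 0 = \<beta> 0"
| "prefix_parity \<beta> (Suc k) = (\<beta> (Suc k) \<noteq> prefix_parity \<beta> k)"

text \<open>The CNOTs run upwards, so when qubit \<open>m\<close> becomes a control it already holds
  the parity of bits \<open>0\<close> to \<open>m\<close>.\<close>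

lemma CNOT_cascade:
  assumes "m < n"
  shows "circuit_mat n (map (\<lambda>k. CNOT k (k + 1)) [0..<m]) =
    bit_map_mat n (\<lambda>\<beta> i. if i \<le> m then prefix_parity \<beta> i else \<beta> i)"
  using assms
proof (induction m)
  case 0
  then show ?case by (auto simp flip: bit_map_mat_id intro!: bit_map_mat_cong)
next
  case (Suc m)
  let ?f = "\<lambda>m \<beta> i. if i \<le> m then prefix_parity \<beta> i else \<beta> i"
  have "circuit_mat n (map (\<lambda>k. CNOT k (k + 1)) [0..<Suc m]) =
      gate_mat n (CNOT m (m + 1)) * bit_map_mat n (?f m)"
    using Suc by (simp add: circuit_mat_append circuit_mat_singleton del: circuit_mat.simps gate_mat.simps)
  also have "\<dots> = bit_map_mat n (\<lambda>\<beta>. (?f m \<beta>)(m + 1 := (?f m \<beta> (m + 1) \<noteq> ?f m \<beta> m)))"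
    unfolding gate_mat.simps using Suc.prems by (intro bit_map_mat_comp bit_local_CNOT) simp
  also have "\<dots> = bit_map_mat n (?f (Suc m))"
    by (intro bit_map_mat_cong) (auto simp: le_Suc_eq)
  finally show ?case .
qed

text \<open>Each SWAP settles one more position at either end. The bound \<open>n div 2\<close>
  keeps the two exchanged positions distinct and not yet moved.\<close>

lemma SWAP_cascade:
  assumes "m \<le> n div 2"
  shows "circuit_mat n (map (\<lambda>i. SWAP i (n - 1 - i)) [0..<m]) =
    bit_map_mat n (\<lambda>\<beta> i. if i < m \<or> n - m \<le> i then \<beta> (n - 1 - i) else \<beta> i)"
  using assms
proof (induction m)
  case 0
  then show ?case by (auto simp flip: bit_map_mat_id intro!: bit_map_mat_cong)
next
  case (Suc m)
  let ?g = "\<lambda>\<beta> :: nat \<Rightarrow> bool. \<beta>(m := \<beta> (n - 1 - m), n - 1 - m := \<beta> m)"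
  let ?f = "\<lambda>m \<beta> i. if i < m \<or> n - m \<le> i then \<beta> (n - 1 - i) else \<beta> i :: bool"
  have "circuit_mat n (map (\<lambda>i. SWAP i (n - 1 - i)) [0..<Suc m]) =
      gate_mat n (SWAP m (n - 1 - m)) * bit_map_mat n (?f m)"
    using Suc by (simp add: circuit_mat_append circuit_mat_singleton del: circuit_mat.simps gate_mat.simps)
  also have "\<dots> = bit_map_mat n (\<lambda>\<beta>. ?g (?f m \<beta>))"
    unfolding gate_mat.simps using Suc.prems by (intro bit_map_mat_comp bit_local_SWAP) auto
  also have "\<dots> = bit_map_mat n (?f (Suc m))"
  proof (rule bit_map_mat_cong)
    fix \<beta> :: "nat \<Rightarrow> bool" and i assume "i < n"
    \<comment> \<open>Only the two exchanged positions change status; everywhere else the conditions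
      for \<open>m\<close> and \<open>Suc m\<close> agree.\<close>
    then consider "i = m" | "i = n - 1 - m" | "i \<noteq> m" "i \<noteq> n - 1 - m" "n - m \<le> i \<longleftrightarrow> n - Suc m \<le> i"
      by linarith
    then show "?g (?f m \<beta>) i = ?f (Suc m) \<beta> i"
      using Suc.prems \<open>i < n\<close> by cases auto
  qed
  finally show ?case .
qed

lemma CNOT_SWAP_cascade:
  assumes "1 \<le> n"
  shows "circuit_mat n (map (\<lambda>k. CNOT k (k + 1)) [0..<n - 1] @
      map (\<lambda>i. SWAP i (n - 1 - i)) [0..<n div 2]) =
    bit_map_mat n (\<lambda>\<beta> i. prefix_parity \<beta> (n - 1 - i))"
proof -
  let ?s = "\<lambda>\<beta> i. if i < n div 2 \<or> n - n div 2 \<le> i then \<beta> (n - 1 - i) else \<beta> i"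
  let ?p = "\<lambda>\<beta> i. if i \<le> n - 1 then prefix_parity \<beta> i else \<beta> i"
  have "bit_local n ?s" by (auto simp: bit_local_def)
  then have "bit_map_mat n ?s * bit_map_mat n ?p = bit_map_mat n (\<lambda>\<beta>. ?s (?p \<beta>))"
    by (rule bit_map_mat_comp)
  also have "\<dots> = bit_map_mat n (\<lambda>\<beta> i. prefix_parity \<beta> (n - 1 - i))"
  proof (rule bit_map_mat_cong)
    fix \<beta> i assume "i < n"
    \<comment> \<open>A position outside both moved halves exists only for odd \<open>n\<close>: it
      is the middle one, its own mirror image.\<close>
    moreover have "n - 1 - i = i" if "\<not> (i < n div 2 \<or> n - n div 2 \<le> i)"
      using that \<open>i < n\<close> by linarith
    moreover have "i \<le> n - 1" "n - 1 - i \<le> n - 1" using \<open>i < n\<close> by auto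
    ultimately show "?s (?p \<beta>) i = prefix_parity \<beta> (n - 1 - i)" by presburger
  qed
  finally show ?thesis
    using assms by (simp only: circuit_mat_append CNOT_cascade[of "n - 1" n] SWAP_cascade[OF order_refl])
qed

subsection \<open>The transform implemented by the circuit\<close>

text \<open>Summation by parts modulo 2: each bit of \<open>\<beta>\<close> is the difference of two consecutive prefix parities.\<close>
lemma even_sum_by_parts:
  "even ((\<Sum>i<Suc m. of_bool (\<beta> i) * of_bool (\<gamma> i)) :: nat) \<longleftrightarrow>
   even ((\<Sum>r<m. of_bool (prefix_parity \<beta> r) * ((of_bool (\<gamma> r) + of_bool (\<gamma> (r + 1))) mod 2)) +
     of_bool (prefix_parity \<beta> m) * of_bool (\<gamma> m) :: nat)"
proof (induction m)
  case (Suc m)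
  \<comment> \<open>Write \<open>p\<close> for the prefix parity. Modulo 2 the right side gains
    \<open>(p m + p (Suc m)) * \<gamma> (Suc m)\<close>, because the old boundary term is absorbed
    into the summand \<open>r = m\<close>. This equals the new left summand, as
    \<open>p m + p (Suc m)\<close> is \<open>\<beta> (Suc m)\<close> modulo 2.\<close>
  then show ?case
    unfolding sum.lessThan_Suc[of _ "Suc m"] sum.lessThan_Suc[of _ m]
    by (auto simp del: sum.lessThan_Suc split: if_splits)
qed simp

lemma prefix_parity_surj: "\<exists>\<beta>. \<forall>k. prefix_parity \<beta> k = \<xi> k"
proof -
  \<comment> \<open>Differences of consecutive target values undo the running parity.\<close>
  define \<beta> where "\<beta> k = (case k of 0 \<Rightarrow> \<xi> 0 | Suc i \<Rightarrow> \<xi> (Suc i) \<noteq> \<xi> i)" for k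
  have "prefix_parity \<beta> k = \<xi> k" for k
    by (induction k) (auto simp: \<beta>_def)
  then show ?thesis by blast
qed

text \<open>Each bit is recovered from two consecutive parities, so nothing beyond position
  \<open>n\<close> enters. This gives the uniqueness of the column found below.\<close>

lemma prefix_parity_inj:
  assumes "\<forall>k<n. prefix_parity \<beta> k = prefix_parity \<gamma> k"
  shows "\<forall>k<n. \<beta> k = \<gamma> k"
proof (intro allI impI)
  fix k assume "k < n"
  then show "\<beta> k = \<gamma> k"
    using assms[rule_format, of k] assms[rule_format, of "k - 1"] by (cases k) auto
qed

lemma prefix_parity_cong:
  assumes "\<forall>k<n. \<beta> k = \<gamma> k"
  shows "k < n \<Longrightarrow> prefix_parity \<beta> k = prefix_parity \<gamma> k"
  using assms by (induction k) auto

lemma index_sequency_circuit: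
  assumes n: "1 \<le> n" and ab: "a < 2 ^ n" "b < 2 ^ n"
  shows "circuit_mat n (sequency_circuit n) $$ (a, b) =
    complex_of_real (1 / sqrt (2 ^ n)) * (- 1) ^ (\<Sum>r<n. binary_digit a (n - 1 - r) *
      ((binary_digit b r + binary_digit b (r + 1)) mod 2))"
proof -
  let ?g = "\<lambda>\<beta> i. prefix_parity \<beta> (n - 1 - i)"
  let ?H = "circuit_mat n (map Hadamard [0..<n])"
  obtain \<beta> where \<beta>: "\<And>k. prefix_parity \<beta> k = bit a (n - 1 - k)"
    using prefix_parity_surj[of "\<lambda>k. bit a (n - 1 - k)"] by blast
  \<comment> \<open>Truncating \<open>\<beta>\<close> to \<open>n\<close> bits keeps its prefix
    parities at positions below \<open>n\<close>.\<close>
  define c where "c = basis_index n \<beta>"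
  have c: "c < 2 ^ n" by (simp add: c_def basis_index_less)
  have par: "prefix_parity (bit c) k = bit a (n - 1 - k)" if "k < n" for k
    using that prefix_parity_cong[of n "bit c" \<beta> k] by (simp add: c_def bit_basis_index \<beta>)
  \<comment> \<open>The sum below runs along row \<open>a\<close> of the bit map, not down a column,
    so the map has to be inverted: \<open>c\<close> is the only column with a nonzero entry.\<close>
  have iff: "(\<forall>i<n. bit a i = ?g (bit c') i) \<longleftrightarrow> c' = c" if "c' < 2 ^ n" for c'
  proof
    assume *: "\<forall>i<n. bit a i = ?g (bit c') i"
    have "prefix_parity (bit c') k = prefix_parity (bit c) k" if "k < n" for k
      using *[rule_format, of "n - 1 - k"] that by (simp add: par)
    then show "c' = c"
      using prefix_parity_inj[of n "bit c'" "bit c"] that c by (intro nat_eq_bitsI) auto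
  next
    assume "c' = c"
    then show "\<forall>i<n. bit a i = ?g (bit c') i" by (simp add: par)
  qed
  have delta: "(if P then 1 else 0) * x = (if P then x else 0)" for P and x :: complex
    by simp
  have "circuit_mat n (sequency_circuit n) = bit_map_mat n ?g * ?H"
    unfolding sequency_circuit_def by (subst circuit_mat_append) (simp only: CNOT_SWAP_cascade[OF n])
  then have "circuit_mat n (sequency_circuit n) $$ (a, b) =
      (\<Sum>c'<2 ^ n. bit_map_mat n ?g $$ (a, c') * ?H $$ (c', b))"
    using ab by (simp add: index_mult_square_mat[of _ "2 ^ n"] del: index_mult_mat)
  also have "\<dots> = (\<Sum>c'<2 ^ n. if \<forall>i<n. bit a i = ?g (bit c') i then ?H $$ (c', b) else 0)"
    using ab by (intro sum.cong refl) (simp only: index_bit_map_mat lessThan_iff delta)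
  also have "\<dots> = ?H $$ (c, b)"
    by (rule sum_single_index[OF c iff])
  also have "\<dots> = complex_of_real (1 / sqrt 2) ^ n * (- 1) ^ (\<Sum>i<n. binary_digit c i * binary_digit b i)"
    using c ab by (simp add: index_Hadamard_layer)
  also have "(- 1) ^ (\<Sum>i<n. binary_digit c i * binary_digit b i) = ((- 1) :: complex) ^
      (\<Sum>r<n. binary_digit a (n - 1 - r) * ((binary_digit b r + binary_digit b (r + 1)) mod 2))"
  proof -
    obtain m where m: "n = Suc m" using n by (cases n) auto
    \<comment> \<open>This is the convention that digit \<open>n\<close> of \<open>b\<close> is 0:
      it turns the boundary term of the summation by parts into the summand
      \<open>r = n - 1\<close>.\<close>
    have "\<not> bit b (Suc m)" using bit_nat_beyond[OF ab(2)] m by simp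
    then have "even (\<Sum>i<n. binary_digit c i * binary_digit b i) \<longleftrightarrow>
      even (\<Sum>r<n. binary_digit a (n - 1 - r) * ((binary_digit b r + binary_digit b (r + 1)) mod 2))"
      using even_sum_by_parts[where m = m and \<beta> = "bit c" and \<gamma> = "bit b"]
      by (simp add: binary_digit_def m par)
    then show ?thesis by (simp add: minus_one_power_iff)
  qed
  finally show ?thesis by (simp add: real_sqrt_power power_divide)
qed

section \<open>The sequency-ordered Walsh-Hadamard matrix and unitarity of the circuit\<close>

lemma dim_sequency_walsh_image [simp]: "dim_vec (sequency_walsh_image n j) = 2 ^ n"
proof -
  have "finsum_vec TYPE(complex) (2 ^ n)
    (\<lambda>k. (- 1) ^ (\<Sum>r<n. binary_digit k (n - 1 - r) *
      ((binary_digit j r + binary_digit j (r + 1)) mod 2)) \<cdot>\<^sub>v ket n k) {0..<2 ^ n}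
    \<in> carrier_vec (2 ^ n)"
    by (rule finsum_vec_closed) auto
  then show ?thesis by (simp add: sequency_walsh_image_def)
qed

lemma index_sequency_walsh_image:
  assumes "k < 2 ^ n"
  shows "sequency_walsh_image n j $ k = complex_of_real (1 / sqrt (2 ^ n)) * (- 1) ^ (\<Sum>r<n. binary_digit k (n - 1 - r) *
      ((binary_digit j r + binary_digit j (r + 1)) mod 2))"
proof -
  let ?v = "\<lambda>k. (- 1) ^ (\<Sum>r<n. binary_digit k (n - 1 - r) *
      ((binary_digit j r + binary_digit j (r + 1)) mod 2)) \<cdot>\<^sub>v ket n k"
  have dim: "finsum_vec TYPE(complex) (2 ^ n) ?v {0..<2 ^ n} \<in> carrier_vec (2 ^ n)"
    by (rule finsum_vec_closed) auto
  have "finsum_vec TYPE(complex) (2 ^ n) ?v {0..<2 ^ n} $ k = (\<Sum>k'\<in>{0..<2 ^ n}. ?v k' $ k)"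
    using assms by (intro index_finsum_vec) auto
  also have "\<dots> = (\<Sum>k'\<in>{0..<2 ^ n}. if k' = k then (- 1) ^ (\<Sum>r<n. binary_digit k (n - 1 - r) *
      ((binary_digit j r + binary_digit j (r + 1)) mod 2)) else 0)"
    using assms by (intro sum.cong) auto
  finally show "sequency_walsh_image n j $ k = complex_of_real (1 / sqrt (2 ^ n)) * (- 1) ^ (\<Sum>r<n.
      binary_digit k (n - 1 - r) * ((binary_digit j r + binary_digit j (r + 1)) mod 2))"
    using assms carrier_vecD[OF dim] by (simp add: sequency_walsh_image_def)
qed

lemma circuit_mat_sequency_circuit:
  assumes "1 \<le> n"
  shows "circuit_mat n (sequency_circuit n) = sequency_walsh_mat n"
proof (rule eq_matI)
  fix i j assume "i < dim_row (sequency_walsh_mat n)" "j < dim_col (sequency_walsh_mat n)"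
  then have "i < 2 ^ n" "j < 2 ^ n" by (auto simp: sequency_walsh_mat_def)
  then show "circuit_mat n (sequency_circuit n) $$ (i, j) = sequency_walsh_mat n $$ (i, j)"
    using assms
    by (simp add: index_sequency_circuit sequency_walsh_mat_def mat_of_cols_index
        index_sequency_walsh_image)
qed (use carrier_matD[OF circuit_mat_carrier] in \<open>simp_all add: sequency_walsh_mat_def\<close>)

lemma sequency_walsh_mat_ket:
  assumes "j < 2 ^ n"
  shows "sequency_walsh_mat n *\<^sub>v ket n j = sequency_walsh_image n j"
proof (rule eq_vecI)
  show "dim_vec (sequency_walsh_mat n *\<^sub>v ket n j) = dim_vec (sequency_walsh_image n j)"
    by (simp add: sequency_walsh_mat_def)
  fix i assume "i < dim_vec (sequency_walsh_image n j)"
  then have "i < 2 ^ n" by simp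
  then show "(sequency_walsh_mat n *\<^sub>v ket n j) $ i = sequency_walsh_image n j $ i"
    using assms by (simp add: sequency_walsh_mat_def mat_of_cols_index)
qed

lemma unitary_sequency_circuit:
  "unitary_mat (2 ^ n) (circuit_mat n (sequency_circuit n))"
proof (rule unitary_circuit_mat)
  fix g assume "g \<in> set (sequency_circuit n)"
  then consider q where "g = Hadamard q" "q < n"
    | k where "g = CNOT k (k + 1)" "k + 1 < n"
    | i where "g = SWAP i (n - 1 - i)" "i < n div 2"
    by (auto simp: sequency_circuit_def)
  then show "unitary_mat (2 ^ n) (gate_mat n g)"
  proof cases
    case 1
    then show ?thesis using unitary_Hadamard by blast
  next
    case 2
    \<comment> \<open>Applying a CNOT twice restores the target because control \<open>k\<close> and
      target \<open>k + 1\<close> differ.\<close>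
    show ?thesis
      unfolding 2(1) gate_mat.simps
      by (intro unitary_bit_map_mat bit_local_CNOT) (use 2(2) in \<open>auto simp: fun_eq_iff\<close>)
  next
    case 3
    show ?thesis
      unfolding 3(1) gate_mat.simps
      by (intro unitary_bit_map_mat bit_local_SWAP) (use 3(2) in auto)
  qed
qed

section \<open>Depth and gate counts\<close>

lemma circuit_depth_le_length: "circuit_depth gs \<le> length gs"
  unfolding circuit_depth_def
  \<comment> \<open>The identity assignment gives every gate a layer of its own.\<close>
  by (rule Least_le) (auto simp: is_layering_def intro!: exI[of _ "\<lambda>i. i"])

lemma real_in_bigo_linear:
  assumes "\<And>n. f n \<le> c * n"
  shows "(\<lambda>n. real (f n)) \<in> O(\<lambda>n. real n)"
proof (rule bigoI[of _ "real c"], rule always_eventually, rule allI)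
  fix n
  show "norm (real (f n)) \<le> real c * norm (real n)"
    using of_nat_mono[OF assms[of n], where 'a = real] by simp
qed

theorem mainTheorem1:
  shows "(\<forall>n\<ge>1.
            unitary_mat (2 ^ n) (circuit_mat n (sequency_circuit n)) \<and>
            circuit_mat n (sequency_circuit n) = sequency_walsh_mat n \<and>
            (\<forall>j<2 ^ n.
               circuit_mat n (sequency_circuit n) *\<^sub>v ket n j =
                 complex_of_real (1 / sqrt (2 ^ n)) \<cdot>\<^sub>v
                   finsum_vec TYPE(complex) (2 ^ n)
                     (\<lambda>k. (- 1) ^ (\<Sum>r<n. binary_digit k (n - 1 - r) *
                              ((binary_digit j r + binary_digit j (r + 1)) mod 2)) \<cdot>\<^sub>v ket n k)
                     {0..<2 ^ n}))
       \<and> (\<lambda>n. real (length (filter is_hadamard (sequency_circuit n)))) \<in> O(\<lambda>n. real n)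
       \<and> (\<lambda>n. real (length (filter is_cnot (sequency_circuit n)))) \<in> O(\<lambda>n. real n)
       \<and> (\<lambda>n. real (length (filter is_swap (sequency_circuit n)))) \<in> O(\<lambda>n. real n)
       \<and> (\<lambda>n. real (circuit_depth (sequency_circuit n))) \<in> O(\<lambda>n. real n)
       \<and> (\<lambda>n. real (circuit_depth (sequency_circuit n))) \<in> O(\<lambda>n. log 2 (2 ^ n))"
proof -
  \<comment> \<open>There are \<open>n\<close> Hadamard, \<open>n - 1\<close> CNOT and
    \<open>n div 2\<close> SWAP gates. This one bound serves all three counts and the depth.\<close>
  have len: "length (sequency_circuit n) \<le> 3 * n" for n
    by (simp add: sequency_circuit_def)
  note bigo = real_in_bigo_linear[OF order_trans[OF _ len]]
  have image: "circuit_mat n (sequency_circuit n) *\<^sub>v ket n j = sequency_walsh_image n j"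
    if "1 \<le> n" "j < 2 ^ n" for n j
    using that by (simp add: circuit_mat_sequency_circuit sequency_walsh_mat_ket)
  \<comment> \<open>This turns the logarithmic depth bound into the linear one.\<close>
  have log: "log 2 (2 ^ n) = real n" for n :: nat
    by (simp add: log_nat_power)
  show ?thesis
    unfolding sequency_walsh_image_def[symmetric] log
    by (intro conjI allI impI unitary_sequency_circuit circuit_mat_sequency_circuit image
        bigo[OF length_filter_le] bigo[OF circuit_depth_le_length])
qed

end
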